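(* Let $A\subseteq\omega$ be a set. Then there exists an $A$-computable frame $F=(W,R)$ such that every valuation $V:W\times\mathrm{Fml}\to\{0,1\}$ on $(W,R)$ computes $A^{(\omega)}$ (i.e. $A^{(\omega)}\leq_T V$).
   Context: $A^{(\omega)}$ is the $\omega$-th Turing jump of $A$. $\mathrm{Prop}$ is an infinite (computable) set of propositional variables; $\mathrm{Fml}$ is the set of modal formulas built from $\mathrm{Prop}\cup\{\bot\}$ using $\rightarrow$ and $\Box$, coded as natural numbers. A frame is a pair $(W,R)$ with $W\subseteq\omega$ non-empty (up to a standard computable coding) and $R\subseteq W\times W$; it is $A$-computable if both $W$ and $R$ are $A$-computable. A valuation on $(W,R)$ is a function $V:W\times\mathrm{Fml}\to\{0,1\}$ such that for all $w\in W$, $\varphi,\psi\in\mathrm{Fml}$: $V(w,\bot)=0$; $V(w,\varphi\to\psi)=1-V(w,\varphi)(1-V(w,\psi))$; $V(w,\Box\varphi)=1\iff\forall u\in W(wRu\to V(u,\varphi)=1)$. No constraint is imposed on the values of $V$ at propositional variables. *)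

theory Defs
  imports Main "HOL-Library.Nat_Bijection" "HOL-Library.FuncSet"
begin

section \<open>Computability relative to an oracle\<close>

text \<open>
  Programs for the unary partial functions that are recursive in a set of natural numbers:
  Kleene's schemata, with tuples of arguments coded by the Cantor pairing \<open>prod_encode\<close>.
\<close>

datatype prog =
    Zero | Succ | Fst | Snd | Query
  | Pair prog prog
  | Comp prog prog
  | Rec prog prog
  | Mu prog

text \<open>
  \<open>None\<close> means divergence.  All schemata are strict: \<open>Rec\<close> diverges as soon as an earlier stage
  does, and \<open>Mu p\<close> returns the least \<open>n\<close> with \<open>p (x, n) = 0\<close> only if \<open>p (x, i)\<close> converges
  for every \<open>i < n\<close>.
\<close>

primrec run :: "prog \<Rightarrow> nat set \<Rightarrow> nat \<Rightarrow> nat option" where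
  "run Zero A x = Some 0"
| "run Succ A x = Some (Suc x)"
| "run Fst A x = Some (fst (prod_decode x))"
| "run Snd A x = Some (snd (prod_decode x))"
| "run Query A x = Some (of_bool (x \<in> A))"
| "run (Pair p q) A x =
     Option.bind (run p A x) (\<lambda>y. Option.bind (run q A x) (\<lambda>z. Some (prod_encode (y, z))))"
| "run (Comp p q) A x = Option.bind (run q A x) (run p A)"
| "run (Rec p q) A x =
     (let (a, m) = prod_decode x in
      rec_nat (run p A a)
        (\<lambda>n r. Option.bind r (\<lambda>y. run q A (prod_encode (a, prod_encode (n, y))))) m)"
| "run (Mu p) A x =
     (let zero_at = (\<lambda>n. run p A (prod_encode (x, n)) = Some 0 \<and>
                         (\<forall>i<n. \<exists>k. run p A (prod_encode (x, i)) = Some (Suc k)))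
      in if \<exists>n. zero_at n then Some (LEAST n. zero_at n) else None)"

definition turing_le :: "nat set \<Rightarrow> nat set \<Rightarrow> bool"  (infix "\<le>\<^sub>T" 50) where
  "B \<le>\<^sub>T A \<longleftrightarrow> (\<exists>p. \<forall>x. run p A x = Some (of_bool (x \<in> B)))"

primrec prog_num :: "prog \<Rightarrow> nat" where
  "prog_num Zero = 0"
| "prog_num Succ = 1"
| "prog_num Fst = 2"
| "prog_num Snd = 3"
| "prog_num Query = 4"
| "prog_num (Pair p q) = 4 * prod_encode (prog_num p, prog_num q) + 5"
| "prog_num (Comp p q) = 4 * prod_encode (prog_num p, prog_num q) + 6"
| "prog_num (Rec p q) = 4 * prod_encode (prog_num p, prog_num q) + 7"
| "prog_num (Mu p) = 4 * prog_num p + 8"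

lemma inj_prog_num: "inj prog_num"
proof (rule injI)
  fix p q show "prog_num p = prog_num q \<Longrightarrow> p = q"
  proof (induction p arbitrary: q)
    case Zero then show ?case by (cases q) auto
  next
    case Succ then show ?case by (cases q) auto
  next
    case Fst then show ?case by (cases q) auto
  next
    case Snd then show ?case by (cases q) auto
  next
    case Query then show ?case by (cases q) auto
  next
    case (Pair a b) then show ?case by (cases q) (auto, presburger+)
  next
    case (Comp a b) then show ?case by (cases q) (auto, presburger+)
  next
    case (Rec a b) then show ?case by (cases q) (auto, presburger+)
  next
    case (Mu a) then show ?case by (cases q) (auto, presburger+)
  qed
qed

lemma surj_prog_num: "surj prog_num"
proof -
  have "\<exists>p. prog_num p = n" for n
  proof (induction n rule: less_induct)
    case (less n)
    show ?case
    proof (cases "n < 5")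
      case True
      then have "n \<in> {prog_num Zero, prog_num Succ, prog_num Fst, prog_num Snd, prog_num Query}"
        by auto
      then show ?thesis by blast
    next
      case False
      define m where "m = (n - 5) div 4"
      obtain a b where ab: "m = prod_encode (a, b)"
        by (metis prod_decode_inverse surj_pair)
      have "m < n" "a < n" "b < n"
        using False le_prod_encode_1[of a b] le_prod_encode_2[of b a] unfolding ab[symmetric] m_def by auto
      then obtain p q r where "prog_num p = a" "prog_num q = b" "prog_num r = m"
        using less.IH by metis
      moreover have "n = 4 * m + 5 \<or> n = 4 * m + 6 \<or> n = 4 * m + 7 \<or> n = 4 * m + 8"
        using False unfolding m_def by presburger
      ultimately have "n \<in> {prog_num (Pair p q), prog_num (Comp p q), prog_num (Rec p q), prog_num (Mu r)}"
        using ab by auto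
      then show ?thesis by blast
    qed
  qed
  then show ?thesis by (metis surjI)
qed

definition Phi :: "nat set \<Rightarrow> nat \<Rightarrow> nat \<Rightarrow> nat option" where
  "Phi A e = run (inv prog_num e) A"

definition jump :: "nat set \<Rightarrow> nat set" where
  "jump A = {e. Phi A e e \<noteq> None}"

definition omega_jump :: "nat set \<Rightarrow> nat set" where
  "omega_jump A = {prod_encode (n, x) | n x. x \<in> (jump ^^ n) A}"


section \<open>Modal formulas, frames and valuations\<close>

datatype fml = Falsum | Var nat | Imp fml fml | Box fml

primrec fml_num :: "fml \<Rightarrow> nat" where
  "fml_num Falsum = 0"
| "fml_num (Var n) = 3 * n + 1"
| "fml_num (Imp \<phi> \<psi>) = 3 * prod_encode (fml_num \<phi>, fml_num \<psi>) + 2"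
| "fml_num (Box \<phi>) = 3 * fml_num \<phi> + 3"

lemma inj_fml_num: "inj fml_num"
proof (rule injI)
  fix \<phi> \<psi> show "fml_num \<phi> = fml_num \<psi> \<Longrightarrow> \<phi> = \<psi>"
  proof (induction \<phi> arbitrary: \<psi>)
    case Falsum then show ?case by (cases \<psi>) auto
  next
    case (Var n) then show ?case by (cases \<psi>) (auto, presburger+)
  next
    case (Imp a b) then show ?case by (cases \<psi>) (auto, presburger+)
  next
    case (Box a) then show ?case by (cases \<psi>) (auto, presburger+)
  qed
qed

definition is_frame :: "nat set \<Rightarrow> (nat \<times> nat) set \<Rightarrow> bool" where
  "is_frame W R \<longleftrightarrow> W \<noteq> {} \<and> R \<subseteq> W \<times> W"

definition computable_frame :: "nat set \<Rightarrow> nat set \<Rightarrow> (nat \<times> nat) set \<Rightarrow> bool" where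
  "computable_frame A W R \<longleftrightarrow> is_frame W R \<and> W \<le>\<^sub>T A \<and> prod_encode ` R \<le>\<^sub>T A"

text \<open>
  Only the restriction of \<open>V\<close> to \<open>W \<times> UNIV\<close> is meaningful.  On values in \<open>{0, 1}\<close> the truncated
  subtraction of \<^typ>\<open>nat\<close> agrees with the integer one.
\<close>

definition valuation :: "nat set \<Rightarrow> (nat \<times> nat) set \<Rightarrow> (nat \<times> fml \<Rightarrow> nat) \<Rightarrow> bool" where
  "valuation W R V \<longleftrightarrow>
     V \<in> W \<times> UNIV \<rightarrow> {0, 1} \<and>
     (\<forall>w\<in>W. \<forall>\<phi> \<psi>.
        V (w, Falsum) = 0 \<and>
        V (w, Imp \<phi> \<psi>) = 1 - V (w, \<phi>) * (1 - V (w, \<psi>)) \<and>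
        (V (w, Box \<phi>) = 1 \<longleftrightarrow> (\<forall>u\<in>W. (w, u) \<in> R \<longrightarrow> V (u, \<phi>) = 1)))"

text \<open>
  As an oracle, the function \<open>V\<close> with domain \<open>W \<times> UNIV\<close> is identified with its coded graph; the
  values of \<open>V\<close> outside \<open>W\<close> do not enter.
\<close>

definition graph_of :: "nat set \<Rightarrow> (nat \<times> fml \<Rightarrow> nat) \<Rightarrow> nat set" where
  "graph_of W V =
     {prod_encode (prod_encode (w, fml_num \<phi>), V (w, \<phi>)) | w \<phi>. w \<in> W}"

end

theory Submission
  imports Defs
begin

text \<open>
  Membership of \<open>x\<close> in the jump of \<open>B\<close> means that there is a finite certificate: a finite set of
  claims \<open>e(x) = y\<close>, locally correct in a way that does not depend on \<open>B\<close>, whose answers to oracle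
  queries agree with \<open>B\<close>.  The frame has worlds for the assertions \<open>x \<in> B\<close> and \<open>x \<notin> B\<close>, the former
  seeing the certificates for \<open>x\<close>, and each certificate sees the assertions about \<open>B\<close> that it makes.
  Neither of these relations mentions \<open>B\<close>, so if a closed formula \<open>\<phi>\<close> defines \<open>B\<close> on the worlds
  \<open>x \<in> B\<close>, then ``some successor is a certificate all of whose successors agree with \<open>\<phi>\<close>''
  defines its jump on the same worlds.  Starting from a formula defining \<open>A\<close> and iterating yields
  closed formulas for all finite jumps, whose values no valuation can choose.
\<close>

section \<open>Total computable functions and decidable predicates\<close>

definition pfst :: "nat \<Rightarrow> nat" where "pfst x = fst (prod_decode x)"
definition psnd :: "nat \<Rightarrow> nat" where "psnd x = snd (prod_decode x)"

lemma pfst_prod_encode [simp]: "pfst (prod_encode (a, b)) = a"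
  and psnd_prod_encode [simp]: "psnd (prod_encode (a, b)) = b"
  and prod_encode_pfst_psnd [simp]: "prod_encode (pfst x, psnd x) = x"
  by (simp_all add: pfst_def psnd_def)

lemma eq_prod_encode_iff: "x = prod_encode (a, b) \<longleftrightarrow> pfst x = a \<and> psnd x = b"
  by auto

definition computable :: "nat set \<Rightarrow> (nat \<Rightarrow> nat) \<Rightarrow> bool" where
  "computable A f \<longleftrightarrow> (\<exists>p. \<forall>x. run p A x = Some (f x))"

definition decidable :: "nat set \<Rightarrow> (nat \<Rightarrow> bool) \<Rightarrow> bool" where
  "decidable A P \<longleftrightarrow> computable A (\<lambda>x. of_bool (P x))"

lemma computableI: "(\<And>x. run p A x = Some (f x)) \<Longrightarrow> computable A f"
  unfolding computable_def by blast

lemma turing_le_iff_decidable: "B \<le>\<^sub>T A \<longleftrightarrow> decidable A (\<lambda>x. x \<in> B)"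
  by (simp add: turing_le_def decidable_def computable_def)

lemma computable_compose:
  assumes "computable A f" "computable A g"
  shows "computable A (\<lambda>x. f (g x))"
proof -
  obtain p where "\<And>x. run p A x = Some (f x)" using assms(1) unfolding computable_def by blast
  moreover obtain q where "\<And>x. run q A x = Some (g x)" using assms(2) unfolding computable_def by blast
  ultimately show ?thesis by (intro computableI[of "Comp p q"]) simp
qed

lemma computable_id: "computable A (\<lambda>x. x)"
proof (rule computableI)
  show "run (Pair Fst Snd) A x = Some x" for x by simp
qed

lemma computable_Suc: "computable A f \<Longrightarrow> computable A (\<lambda>x. Suc (f x))"
  by (rule computable_compose[of A Suc]) (auto intro: computableI[of Succ])

lemma computable_pfst: "computable A f \<Longrightarrow> computable A (\<lambda>x. pfst (f x))"
  by (rule computable_compose[of A pfst]) (auto intro: computableI[of Fst] simp: pfst_def)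

lemma computable_psnd: "computable A f \<Longrightarrow> computable A (\<lambda>x. psnd (f x))"
  by (rule computable_compose[of A psnd]) (auto intro: computableI[of Snd] simp: psnd_def)

lemma computable_prod_encode:
  assumes "computable A f" "computable A g"
  shows "computable A (\<lambda>x. prod_encode (f x, g x))"
proof -
  obtain p where "\<And>x. run p A x = Some (f x)" using assms(1) unfolding computable_def by blast
  moreover obtain q where "\<And>x. run q A x = Some (g x)" using assms(2) unfolding computable_def by blast
  ultimately show ?thesis by (intro computableI[of "Pair p q"]) simp
qed

lemma computable_const: "computable A (\<lambda>x. k)"
proof (induction k)
  case 0
  show ?case by (rule computableI[of Zero]) simp
qed (rule computable_Suc)

lemma computable_rec_nat:
  assumes "computable A f" "computable A m"
    and "computable A (\<lambda>z. g (pfst z) (pfst (psnd z)) (psnd (psnd z)))"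
  shows "computable A (\<lambda>x. rec_nat (f x) (g x) (m x))"
proof -
  obtain p where p: "\<And>x. run p A x = Some (f x)"
    using assms(1) unfolding computable_def by blast
  obtain q where q: "\<And>z. run q A z = Some (g (pfst z) (pfst (psnd z)) (psnd (psnd z)))"
    using assms(3) unfolding computable_def by blast
  have "run (Rec p q) A z = Some (rec_nat (f (pfst z)) (g (pfst z)) (psnd z))" for z
  proof -
    have "rec_nat (run p A a) (\<lambda>n r. Option.bind r
        (\<lambda>y. run q A (prod_encode (a, prod_encode (n, y))))) n = Some (rec_nat (f a) (g a) n)" for a n
      by (induction n) (simp_all add: p q)
    then show ?thesis by (simp add: pfst_def psnd_def split: prod.split)
  qed
  then have "computable A (\<lambda>z. rec_nat (f (pfst z)) (g (pfst z)) (psnd z))"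
    by (rule computableI)
  from computable_compose[OF this computable_prod_encode[OF computable_id assms(2)]]
  show ?thesis by simp
qed

lemmas computable_basic_intros =
  computable_id computable_const computable_Suc computable_pfst computable_psnd
  computable_prod_encode computable_rec_nat

lemma computable_add:
  assumes "computable A f" "computable A g"
  shows "computable A (\<lambda>x. f x + g x)"
proof -
  have "a + b = rec_nat a (\<lambda>_ r. Suc r) b" for a b :: nat by (induction b) simp_all
  then show ?thesis using assms by (simp only:) (intro computable_basic_intros)
qed

lemma computable_mult:
  assumes "computable A f" "computable A g"
  shows "computable A (\<lambda>x. f x * g x)"
proof -
  have "a * b = rec_nat 0 (\<lambda>_ r. r + a) b" for a b :: nat by (induction b) simp_all
  then show ?thesis using assms
    by (simp only:) (intro computable_basic_intros computable_add computable_compose[OF assms(1)])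
qed

lemma computable_diff:
  assumes "computable A f" "computable A g"
  shows "computable A (\<lambda>x. f x - g x)"
proof -
  have pred: "a - 1 = rec_nat 0 (\<lambda>n _. n) a" for a :: nat by (cases a) simp_all
  have "a - b = rec_nat a (\<lambda>_ r. rec_nat 0 (\<lambda>n _. n) r) b" for a b :: nat
    by (induction b) (simp_all flip: pred)
  then show ?thesis using assms by (simp only:) (intro computable_basic_intros)
qed

lemma computable_mod_2:
  assumes "computable A f"
  shows "computable A (\<lambda>x. f x mod 2)"
proof -
  have "a mod 2 = rec_nat 0 (\<lambda>_ r. 1 - r) a" for a :: nat
    by (induction a) (simp_all flip: One_nat_def, presburger)
  then show ?thesis using assms
    by (simp only:) (intro computable_basic_intros computable_diff)
qed

lemma computable_div_2:
  assumes "computable A f"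
  shows "computable A (\<lambda>x. f x div 2)"
proof -
  have "a div 2 = rec_nat 0 (\<lambda>n r. r + n mod 2) a" for a :: nat
  proof (induction a)
    case (Suc a)
    have "Suc a div 2 = a div 2 + a mod 2" by presburger
    with Suc show ?case by simp
  qed simp
  then show ?thesis using assms
    by (simp only:) (intro computable_basic_intros computable_add computable_mod_2)
qed

lemmas computable_intros =
  computable_basic_intros computable_add computable_mult computable_diff

section \<open>Closure properties of decidable predicates\<close>

lemma decidable_const: "decidable A (\<lambda>x. b)"
  unfolding decidable_def by (rule computable_const)

lemma decidable_not:
  assumes "decidable A P"
  shows "decidable A (\<lambda>x. \<not> P x)"
proof -
  have "(of_bool (\<not> b) :: nat) = 1 - of_bool b" for b by (cases b) simp_all
  then show ?thesis using assms unfolding decidable_def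
    by (simp only:) (intro computable_intros)
qed

lemma decidable_conj:
  assumes "decidable A P" "decidable A Q"
  shows "decidable A (\<lambda>x. P x \<and> Q x)"
proof -
  have "(of_bool (b \<and> c) :: nat) = of_bool b * of_bool c" for b c by simp
  then show ?thesis using assms unfolding decidable_def
    by (simp only:) (intro computable_intros)
qed

lemma decidable_disj:
  assumes "decidable A P" "decidable A Q"
  shows "decidable A (\<lambda>x. P x \<or> Q x)"
proof -
  have "decidable A (\<lambda>x. \<not> (\<not> P x \<and> \<not> Q x))"
    by (intro decidable_not decidable_conj assms)
  then show ?thesis by simp
qed

lemma decidable_le:
  assumes "computable A f" "computable A g"
  shows "decidable A (\<lambda>x. f x \<le> g x)"
proof -
  have "(of_bool (a \<le> b) :: nat) = 1 - (a - b)" for a b :: nat by simp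
  then show ?thesis using assms unfolding decidable_def
    by (simp only:) (intro computable_intros)
qed

lemma decidable_eq:
  assumes "computable A f" "computable A g"
  shows "decidable A (\<lambda>x. f x = g x)"
  unfolding eq_iff by (intro decidable_conj decidable_le assms)

lemma decidable_ex_less:
  assumes "computable A b" "decidable A (\<lambda>z. P (pfst z) (psnd z))"
  shows "decidable A (\<lambda>x. \<exists>i<b x. P x i)"
proof -
  \<comment> \<open>The double truncated subtraction sends 0 to 0 and every positive number to 1,
    which makes addition a disjunction.\<close>
  have eq: "(of_bool (\<exists>i<n. Q i) :: nat) = rec_nat 0 (\<lambda>i r. 1 - (1 - (r + of_bool (Q i)))) n"
    for Q :: "nat \<Rightarrow> bool" and n
  proof (induction n)
    case (Suc n)
    have "(\<exists>i<Suc n. Q i) \<longleftrightarrow> (\<exists>i<n. Q i) \<or> Q n" by (auto simp: less_Suc_eq)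
    then show ?case by (simp only: old.nat.simps Suc.IH[symmetric]) auto
  qed simp
  have "computable A (\<lambda>z. of_bool (P (pfst z) (pfst (psnd z))))"
    using computable_compose[OF assms(2)[unfolded decidable_def],
        of "\<lambda>z. prod_encode (pfst z, pfst (psnd z))"]
    by (simp add: computable_intros)
  then show ?thesis unfolding decidable_def eq by (intro computable_intros assms)
qed

lemma decidable_all_less:
  assumes "computable A b" "decidable A (\<lambda>z. P (pfst z) (psnd z))"
  shows "decidable A (\<lambda>x. \<forall>i<b x. P x i)"
proof -
  have "decidable A (\<lambda>x. \<not> (\<exists>i<b x. \<not> P x i))"
    by (intro decidable_not decidable_ex_less assms)
  then show ?thesis by simp
qed

lemma decidable_ex_le:
  assumes "computable A b" "decidable A (\<lambda>z. P (pfst z) (psnd z))"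
  shows "decidable A (\<lambda>x. \<exists>i\<le>b x. P x i)"
  unfolding less_Suc_eq_le[symmetric] by (intro decidable_ex_less computable_Suc assms)

lemma decidable_oracle:
  assumes "computable A f"
  shows "decidable A (\<lambda>x. f x \<in> A)"
  unfolding decidable_def
  by (rule computable_compose[of A "\<lambda>y. of_bool (y \<in> A)"])
    (auto intro: assms computableI[of Query])

text \<open>A finite set is coded by the binary digits of a number: halving \<open>t\<close> times
  and taking the parity reads digit \<open>t\<close>.\<close>

lemma decidable_set_decode:
  assumes "computable A f" "computable A g"
  shows "decidable A (\<lambda>x. f x \<in> set_decode (g x))"
proof -
  have "(of_bool (t \<in> set_decode c) :: nat) = rec_nat c (\<lambda>_ r. r div 2) t mod 2" for t c
  proof -
    have "rec_nat c (\<lambda>_ r. r div 2) t = c div 2 ^ t"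
      by (induction t) (simp_all add: div_mult2_eq[symmetric] mult.commute)
    then show ?thesis by (simp add: set_decode_def odd_iff_mod_2_eq_one)
  qed
  then show ?thesis using assms unfolding decidable_def
    by (simp only:) (intro computable_intros computable_mod_2 computable_div_2)
qed

text \<open>This bound turns quantification over the elements of a coded set into bounded
  quantification.\<close>

lemma set_decode_less: "t \<in> set_decode c \<Longrightarrow> t < c"
proof -
  assume "t \<in> set_decode c"
  then have "c div 2 ^ t \<noteq> 0" unfolding set_decode_def by (auto intro: ccontr)
  then have "2 ^ t \<le> c" by (simp add: div_eq_0_iff)
  with less_exp[of t] show ?thesis by linarith
qed

lemma decidable_Bex_set_decode:
  assumes "computable A f" "decidable A (\<lambda>z. P (pfst z) (psnd z))"
  shows "decidable A (\<lambda>x. \<exists>t\<in>set_decode (f x). P x t)"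
proof -
  have "decidable A (\<lambda>x. \<exists>t<f x. t \<in> set_decode (f x) \<and> P x t)"
    by (intro decidable_ex_less decidable_conj decidable_set_decode computable_intros
        computable_compose[OF assms(1)] assms)
  moreover have "(\<exists>t<f x. t \<in> set_decode (f x) \<and> P x t) \<longleftrightarrow> (\<exists>t\<in>set_decode (f x). P x t)" for x
    using set_decode_less by blast
  ultimately show ?thesis by simp
qed

lemma decidable_Ball_set_decode:
  assumes "computable A f" "decidable A (\<lambda>z. P (pfst z) (psnd z))"
  shows "decidable A (\<lambda>x. \<forall>t\<in>set_decode (f x). P x t)"
proof -
  have "decidable A (\<lambda>x. \<not> (\<exists>t\<in>set_decode (f x). \<not> P x t))"
    by (intro decidable_not decidable_Bex_set_decode assms)
  then show ?thesis by simp
qed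

lemmas decidable_intros =
  decidable_const decidable_not decidable_conj decidable_disj decidable_le
  decidable_eq decidable_ex_less decidable_all_less decidable_ex_le decidable_oracle
  decidable_set_decode decidable_Bex_set_decode decidable_Ball_set_decode


section \<open>Finite certificates of computations\<close>

definition claim :: "nat \<Rightarrow> nat \<Rightarrow> nat \<Rightarrow> nat" where
  "claim e x y = prod_encode (e, prod_encode (x, y))"
definition prg :: "nat \<Rightarrow> nat" where "prg t = pfst t"
definition inp :: "nat \<Rightarrow> nat" where "inp t = pfst (psnd t)"
definition out :: "nat \<Rightarrow> nat" where "out t = psnd (psnd t)"

lemma claim_simps [simp]:
  "prg (claim e x y) = e" "inp (claim e x y) = x" "out (claim e x y) = y"
  "claim (prg t) (inp t) (out t) = t"
  by (simp_all add: claim_def prg_def inp_def out_def)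

text \<open>
  Local correctness of a single claim \<open>e(x) = y\<close> given the claims in \<open>S\<close>, one disjunct per
  constructor of \<^typ>\<open>prog\<close>, with all quantifiers bounded so that it is decidable.  No order on the
  claims is needed to exclude circular justifications: every claim appeals to smaller programs, or
  to the same \<^const>\<open>Rec\<close> with a smaller recursion argument.  Oracle answers are unconstrained here.
\<close>

definition justified :: "nat set \<Rightarrow> nat \<Rightarrow> nat \<Rightarrow> nat \<Rightarrow> bool" where
  "justified S e x y \<longleftrightarrow>
     e = 0 \<and> y = 0 \<or> e = 1 \<and> y = Suc x \<or> e = 2 \<and> y = pfst x \<or> e = 3 \<and> y = psnd x \<or>
     e = 4 \<and> y \<le> 1 \<or>
     (\<exists>t\<in>S. \<exists>s\<in>S. e = 4 * prod_encode (prg t, prg s) + 5 \<and>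
        inp t = x \<and> inp s = x \<and> y = prod_encode (out t, out s)) \<or>
     (\<exists>t\<in>S. \<exists>s\<in>S. e = 4 * prod_encode (prg t, prg s) + 6 \<and>
        inp s = x \<and> inp t = out s \<and> y = out t) \<or>
     (\<exists>t\<in>S. \<exists>b\<le>e. e = 4 * prod_encode (prg t, b) + 7 \<and>
        x = prod_encode (inp t, 0) \<and> y = out t) \<or>
     (\<exists>t\<in>S. \<exists>s\<in>S. \<exists>a\<le>e. e = 4 * prod_encode (a, prg s) + 7 \<and> prg t = e \<and>
        x = prod_encode (pfst (inp t), Suc (psnd (inp t))) \<and>
        inp s = prod_encode (pfst (inp t), prod_encode (psnd (inp t), out t)) \<and> y = out s) \<or>
     (\<exists>t\<in>S. e = 4 * prg t + 8 \<and> inp t = prod_encode (x, y) \<and> out t = 0 \<and>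
        (\<forall>i<y. \<exists>s\<in>S. prg s = prg t \<and> inp s = prod_encode (x, i) \<and> 1 \<le> out s))"

definition closed_claims :: "nat set \<Rightarrow> bool" where
  "closed_claims S \<longleftrightarrow> (\<forall>t\<in>S. justified S (prg t) (inp t) (out t))"

text \<open>The last conjunct ensures that the world of a certificate has a successor, unlike \<open>dead\<close> below.\<close>

definition certifies :: "nat set \<Rightarrow> nat \<Rightarrow> bool" where
  "certifies S x \<longleftrightarrow> closed_claims S \<and> (\<exists>t\<in>S. prg t = x \<and> inp t = x) \<and> (\<exists>t\<in>S. prg t = 4)"

definition query_correct :: "nat set \<Rightarrow> nat set \<Rightarrow> bool" where
  "query_correct B S \<longleftrightarrow> (\<forall>t\<in>S. prg t = 4 \<longrightarrow> out t = of_bool (inp t \<in> B))"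

text \<open>Every quantifier in the definition ranges over a coded finite set or an initial segment,
  so the closure rules suffice. Set code and input are first paired into one argument because these
  rules are unary.\<close>

lemma decidable_certifies:
  assumes "computable A f" "computable A g"
  shows "decidable A (\<lambda>x. certifies (set_decode (f x)) (g x))"
proof -
  have "decidable A (\<lambda>z. certifies (set_decode (pfst z)) (psnd z))"
    unfolding certifies_def closed_claims_def justified_def prg_def inp_def out_def
    by (intro decidable_intros computable_intros)
  from computable_compose[OF this[unfolded decidable_def] computable_prod_encode[OF assms]]
  show ?thesis unfolding decidable_def by simp
qed

section \<open>Local correctness, one constructor at a time\<close>

lemma justified_basic:
  "justified S 0 x y \<longleftrightarrow> y = 0" "justified S 1 x y \<longleftrightarrow> y = Suc x"
  "justified S 2 x y \<longleftrightarrow> y = pfst x" "justified S 3 x y \<longleftrightarrow> y = psnd x"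
  "justified S 4 x y \<longleftrightarrow> y \<le> 1"
  by (auto simp: justified_def)

text \<open>The offsets 5, 6, 7, 8 are pairwise incongruent modulo 4; this rules out the disjuncts
  of \<open>justified\<close> that belong to other constructors.\<close>

lemma prog_num_mod_4:
  fixes m n :: nat
  shows "4 * m + 5 \<noteq> 4 * n + 6" "4 * m + 5 \<noteq> 4 * n + 7" "4 * m + 5 \<noteq> 4 * n + 8"
    "4 * m + 6 \<noteq> 4 * n + 7" "4 * m + 6 \<noteq> 4 * n + 8" "4 * m + 7 \<noteq> 4 * n + 8"
  by presburger+

text \<open>Every number codes a claim, so the projections of a bound \<open>t\<close> can be
  simplified away.\<close>

lemma bex_claim: "(\<exists>t\<in>S. P t) \<longleftrightarrow> (\<exists>e x y. claim e x y \<in> S \<and> P (claim e x y))"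
  by (metis claim_simps(4))

lemma justified_Pair:
  "justified S (4 * prod_encode (a, b) + 5) x y \<longleftrightarrow>
     (\<exists>u v. claim a x u \<in> S \<and> claim b x v \<in> S \<and> y = prod_encode (u, v))"
  unfolding justified_def bex_claim by (auto simp: prog_num_mod_4 prog_num_mod_4[symmetric])

lemma justified_Comp:
  "justified S (4 * prod_encode (a, b) + 6) x y \<longleftrightarrow>
     (\<exists>z. claim b x z \<in> S \<and> claim a z y \<in> S)"
  unfolding justified_def bex_claim by (auto simp: prog_num_mod_4 prog_num_mod_4[symmetric])

text \<open>These discharge the bounds on the program codes quantified in the two \<open>Rec\<close>
  clauses of \<open>justified\<close>.\<close>

lemma prod_encode_bounds:
  "a \<le> 4 * prod_encode (a, b) + c" "b \<le> 4 * prod_encode (a, b) + c"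
  using le_prod_encode_1[of a b] le_prod_encode_2[of b a] by linarith+

lemma justified_Rec:
  "justified S (4 * prod_encode (a, b) + 7) (prod_encode (k, m)) y \<longleftrightarrow>
     (case m of 0 \<Rightarrow> claim a k y \<in> S
      | Suc n \<Rightarrow> \<exists>z. claim (4 * prod_encode (a, b) + 7) (prod_encode (k, n)) z \<in> S \<and>
                 claim b (prod_encode (k, prod_encode (n, z))) y \<in> S)"
  unfolding justified_def bex_claim
  by (cases m)
    (auto simp: prog_num_mod_4 prog_num_mod_4[symmetric] prod_encode_bounds,
      metis pfst_prod_encode psnd_prod_encode)

lemma justified_Mu:
  "justified S (4 * a + 8) x y \<longleftrightarrow>
     claim a (prod_encode (x, y)) 0 \<in> S \<and> (\<forall>i<y. \<exists>k. claim a (prod_encode (x, i)) (Suc k) \<in> S)"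
  unfolding justified_def bex_claim
  by (auto simp: prog_num_mod_4 prog_num_mod_4[symmetric]) (metis Suc_le_D less_eq_Suc_le One_nat_def)

lemma closed_claimsD: "closed_claims S \<Longrightarrow> claim e x y \<in> S \<Longrightarrow> justified S e x y"
  unfolding closed_claims_def by (metis claim_simps(1-3))

text \<open>Soundness of certificates. The oracle matters directly only at \<open>Query\<close>,
  where \<open>query_correct\<close> applies. Justifications lead to subprograms, except for
  \<open>Rec\<close>, where an inner induction on the recursion argument is added.\<close>

lemma run_of_closed_claims:
  assumes S: "closed_claims S" "query_correct B S"
  shows "claim (prog_num p) x y \<in> S \<Longrightarrow> run p B x = Some y"
proof (induction p arbitrary: x y)
  case Zero
  from closed_claimsD[OF S(1) Zero] show ?case by (simp add: justified_basic)
next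
  case Succ
  from closed_claimsD[OF S(1) Succ] show ?case by (simp add: justified_basic flip: One_nat_def)
next
  case Fst
  from closed_claimsD[OF S(1) Fst] show ?case by (simp add: justified_basic pfst_def)
next
  case Snd
  from closed_claimsD[OF S(1) Snd] show ?case by (simp add: justified_basic psnd_def)
next
  case Query
  then show ?case using S(2) by (force simp: query_correct_def)
next
  case (Pair p q)
  from closed_claimsD[OF S(1) Pair.prems] show ?case
    using Pair.IH by (auto simp: justified_Pair)
next
  case (Comp p q)
  from closed_claimsD[OF S(1) Comp.prems] show ?case
    using Comp.IH by (auto simp: justified_Comp)
next
  case (Rec p q)
  define k m where "k = pfst x" and "m = psnd x"
  then have x: "x = prod_encode (k, m)" by simp
  have "claim (prog_num (Rec p q)) (prod_encode (k, m)) y \<in> S \<Longrightarrow>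
    run (Rec p q) B (prod_encode (k, m)) = Some y" for m y
  proof (induction m arbitrary: y)
    case 0
    from closed_claimsD[OF S(1) this] show ?case using Rec.IH by (simp add: justified_Rec)
  next
    case (Suc m)
    obtain z where "claim (prog_num (Rec p q)) (prod_encode (k, m)) z \<in> S"
      "claim (prog_num q) (prod_encode (k, prod_encode (m, z))) y \<in> S"
      using closed_claimsD[OF S(1) Suc.prems] by (auto simp: justified_Rec)
    then show ?case using Suc.IH Rec.IH by force
  qed
  with Rec.prems x show ?case by simp
next
  case (Mu p)
  have "claim (prog_num p) (prod_encode (x, y)) 0 \<in> S"
    and "\<forall>i<y. \<exists>k. claim (prog_num p) (prod_encode (x, i)) (Suc k) \<in> S"
    using closed_claimsD[OF S(1) Mu.prems] by (simp_all add: justified_Mu)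
  with Mu.IH have y: "run p B (prod_encode (x, y)) = Some 0"
    and less: "\<forall>i<y. \<exists>k. run p B (prod_encode (x, i)) = Some (Suc k)" by blast+
  define zero_at where "zero_at n \<longleftrightarrow> run p B (prod_encode (x, n)) = Some 0 \<and>
    (\<forall>i<n. \<exists>k. run p B (prod_encode (x, i)) = Some (Suc k))" for n
  have "zero_at y" using y less by (simp add: zero_at_def)
  moreover have "(LEAST n. zero_at n) = y"
    using \<open>zero_at y\<close> less by (intro Least_equality) (force simp: zero_at_def not_less[symmetric])+
  ultimately show ?case by (auto simp: Let_def simp flip: zero_at_def)
qed

section \<open>Completeness: every halting computation has a finite certificate\<close>

lemma justified_mono: "S \<subseteq> S' \<Longrightarrow> justified S e x y \<Longrightarrow> justified S' e x y"
  unfolding justified_def by (elim disj_forward; blast)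

definition correct_claims :: "nat set \<Rightarrow> nat set \<Rightarrow> bool" where
  "correct_claims B S \<longleftrightarrow> finite S \<and> closed_claims S \<and> query_correct B S"

text \<open>The set of claims occurs only positively in \<open>justified\<close>, so adding claims
  never destroys a justification and certificates can be merged.\<close>

lemma correct_claims_UN:
  "finite I \<Longrightarrow> (\<And>i. i \<in> I \<Longrightarrow> correct_claims B (S i)) \<Longrightarrow> correct_claims B (\<Union>i\<in>I. S i)"
  unfolding correct_claims_def closed_claims_def query_correct_def
  by (auto intro: justified_mono[rotated])

lemma correct_claims_Un:
  "correct_claims B S \<Longrightarrow> correct_claims B S' \<Longrightarrow> correct_claims B (S \<union> S')"
  unfolding correct_claims_def closed_claims_def query_correct_def
  by (auto intro: justified_mono[rotated])

lemma correct_claims_insert: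
  assumes "correct_claims B S" "justified S e x y" "e = 4 \<longrightarrow> y = of_bool (x \<in> B)"
  shows "correct_claims B (insert (claim e x y) S)"
  using assms unfolding correct_claims_def closed_claims_def query_correct_def
  by (auto intro: justified_mono[rotated, of S])

definition certified :: "nat set \<Rightarrow> nat \<Rightarrow> nat \<Rightarrow> nat \<Rightarrow> bool" where
  "certified B e x y \<longleftrightarrow> (\<exists>S. correct_claims B S \<and> claim e x y \<in> S)"

text \<open>Code 4 is excluded because \<open>justified\<close> accepts either answer to an oracle
  query; \<open>certified_Query\<close> treats that case.\<close>

lemma certifiedI:
  "correct_claims B S \<Longrightarrow> justified S e x y \<Longrightarrow> e \<noteq> 4 \<Longrightarrow> certified B e x y"
  unfolding certified_def using correct_claims_insert by blast

lemma correct_claims_empty: "correct_claims B {}"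
  by (simp add: correct_claims_def closed_claims_def query_correct_def)

lemma certified_Query: "certified B 4 x (of_bool (x \<in> B))"
proof -
  have "correct_claims B {claim 4 x (of_bool (x \<in> B))}"
    by (intro correct_claims_insert correct_claims_empty) (simp_all add: justified_basic)
  then show ?thesis unfolding certified_def by blast
qed

lemma certified2:
  assumes "certified B e x y" "certified B e' x' y'"
  obtains S where "correct_claims B S" "claim e x y \<in> S" "claim e' x' y' \<in> S"
  using assms unfolding certified_def by (meson UnI1 UnI2 correct_claims_Un)

text \<open>A halting run involves finitely many subcomputations. Their certificates are united, and
  the claim for the whole run is added.\<close>

lemma certified_of_run: "run p B x = Some y \<Longrightarrow> certified B (prog_num p) x y"
proof (induction p arbitrary: x y)
  case Zero
  then show ?case by (intro certifiedI[OF correct_claims_empty]) (simp_all add: justified_basic)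
next
  case Succ
  then show ?case by (intro certifiedI[OF correct_claims_empty]) (simp_all add: justified_basic flip: One_nat_def)
next
  case Fst
  then show ?case by (intro certifiedI[OF correct_claims_empty]) (simp_all add: justified_basic pfst_def)
next
  case Snd
  then show ?case by (intro certifiedI[OF correct_claims_empty]) (simp_all add: justified_basic psnd_def)
next
  case Query
  then show ?case using certified_Query[of B x] by simp
next
  case (Pair p q)
  then obtain u v where "certified B (prog_num p) x u" "certified B (prog_num q) x v"
    and y: "y = prod_encode (u, v)"
    by (auto simp: bind_eq_Some_conv)
  then obtain S where "correct_claims B S" "claim (prog_num p) x u \<in> S" "claim (prog_num q) x v \<in> S"
    by (metis certified2)
  then show ?case by (auto intro!: certifiedI simp: justified_Pair y)
next
  case (Comp p q)
  then obtain z where "run q B x = Some z" "run p B z = Some y"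
    by (auto simp: bind_eq_Some_conv)
  then have "certified B (prog_num q) x z" "certified B (prog_num p) z y"
    using Comp.IH by blast+
  then obtain S where "correct_claims B S" "claim (prog_num q) x z \<in> S" "claim (prog_num p) z y \<in> S"
    by (metis certified2)
  then show ?case by (auto intro!: certifiedI simp: justified_Comp)
next
  case (Rec p q)
  define k m where "k = pfst x" and "m = psnd x"
  then have x: "x = prod_encode (k, m)" by simp
  have "run (Rec p q) B (prod_encode (k, m)) = Some y \<Longrightarrow>
    certified B (prog_num (Rec p q)) (prod_encode (k, m)) y" for m y
  proof (induction m arbitrary: y)
    case 0
    then have "certified B (prog_num p) k y" using Rec.IH by simp
    then show ?case
      unfolding certified_def[of B "prog_num p"] by (auto intro!: certifiedI simp: justified_Rec)
  next
    case (Suc m)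
    then obtain z where "run (Rec p q) B (prod_encode (k, m)) = Some z"
      "run q B (prod_encode (k, prod_encode (m, z))) = Some y"
      by (auto simp: bind_eq_Some_conv)
    then have "certified B (prog_num (Rec p q)) (prod_encode (k, m)) z"
      "certified B (prog_num q) (prod_encode (k, prod_encode (m, z))) y"
      using Suc.IH Rec.IH by blast+
    then obtain S where "correct_claims B S"
      "claim (prog_num (Rec p q)) (prod_encode (k, m)) z \<in> S"
      "claim (prog_num q) (prod_encode (k, prod_encode (m, z))) y \<in> S"
      by (metis certified2)
    then show ?case by (auto intro!: certifiedI simp: justified_Rec)
  qed
  with Rec.prems x show ?case by simp
next
  case (Mu p)
  define zero_at where "zero_at n \<longleftrightarrow> run p B (prod_encode (x, n)) = Some 0 \<and>
    (\<forall>i<n. \<exists>k. run p B (prod_encode (x, i)) = Some (Suc k))" for n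
  have "run (Mu p) B x = (if \<exists>n. zero_at n then Some (LEAST n. zero_at n) else None)"
    by (simp only: run.simps Let_def zero_at_def)
  with Mu.prems have "\<exists>n. zero_at n" "y = (LEAST n. zero_at n)" by (auto split: if_splits)
  then have "zero_at y" by (auto intro: LeastI)
  \<comment> \<open>Both clauses of \<open>zero_at\<close> are put into one family of values that
    vanishes exactly at \<open>y\<close>, so that one choice of certificates covers all stages of
    the search.\<close>
  then have "\<forall>i\<le>y. \<exists>k. run p B (prod_encode (x, i)) = Some k \<and> (k = 0 \<longleftrightarrow> i = y)"
    unfolding zero_at_def by (metis Zero_not_Suc le_neq_implies_less less_irrefl)
  then obtain k where k: "\<And>i. i \<le> y \<Longrightarrow> run p B (prod_encode (x, i)) = Some (k i)"
    "\<And>i. i \<le> y \<Longrightarrow> k i = 0 \<longleftrightarrow> i = y" by metis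
  then have "\<forall>i\<in>{..y}. \<exists>S. correct_claims B S \<and> claim (prog_num p) (prod_encode (x, i)) (k i) \<in> S"
    using Mu.IH unfolding certified_def by simp
  then obtain S where S: "\<And>i. i \<in> {..y} \<Longrightarrow> correct_claims B (S i)"
    "\<And>i. i \<in> {..y} \<Longrightarrow> claim (prog_num p) (prod_encode (x, i)) (k i) \<in> S i" by metis
  let ?S = "\<Union>i\<in>{..y}. S i"
  have "claim (prog_num p) (prod_encode (x, i)) (k i) \<in> ?S" if "i \<le> y" for i
    using S(2) that by blast
  then have "justified ?S (prog_num (Mu p)) x y"
    unfolding prog_num.simps justified_Mu by (metis k(2) le_refl less_imp_le not0_implies_Suc less_irrefl)
  with correct_claims_UN[of "{..y}" B S] S(1) show ?case by (intro certifiedI) auto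
qed

text \<open>The two conjuncts separate what the frame can record without knowing \<open>B\<close>
  from what a modal formula has to express about \<open>B\<close>.\<close>

lemma mem_jump_iff_certifies:
  "x \<in> jump B \<longleftrightarrow> (\<exists>c. certifies (set_decode c) x \<and> query_correct B (set_decode c))"
proof -
  define p where "p = inv prog_num x"
  have p: "prog_num p = x" unfolding p_def using surj_prog_num by (rule surj_f_inv_f)
  have jump: "x \<in> jump B \<longleftrightarrow> (\<exists>y. run p B x = Some y)" by (simp add: jump_def Phi_def flip: p_def)
  show ?thesis
  proof
    assume "x \<in> jump B"
    then obtain y where "certified B x x y" using certified_of_run[of p B x] p jump by auto
    \<comment> \<open>The computation may ask no query at all. A correct answer about 0 is added to
      satisfy the last conjunct of \<open>certifies\<close>.\<close>
    then obtain S where S: "correct_claims B S" "claim x x y \<in> S"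
      and "claim 4 0 (of_bool (0 \<in> B)) \<in> S" using certified_Query by (rule certified2)
    then have "certifies S x" "query_correct B S" "set_decode (set_encode S) = S"
      unfolding certifies_def correct_claims_def
      by (auto intro: bexI[of _ "claim x x y"] bexI[of _ "claim 4 0 (of_bool (0 \<in> B))"]
          simp: set_encode_inverse simp del: of_bool_eq_iff)
    then show "\<exists>c. certifies (set_decode c) x \<and> query_correct B (set_decode c)" by metis
  next
    assume "\<exists>c. certifies (set_decode c) x \<and> query_correct B (set_decode c)"
    then obtain S t where "closed_claims S" "query_correct B S" "claim x x (out t) \<in> S"
      unfolding certifies_def by (metis claim_simps(4))
    then show "x \<in> jump B" using run_of_closed_claims[of S B p x "out t"] p jump by auto
  qed
qed


section \<open>The frame\<close>

text \<open>
  \<open>literal b x\<close> stands for \<open>x \<in> B\<close> or \<open>x \<notin> B\<close>.  Among the successors of a positive literal,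
  only \<open>mark\<close> and \<open>dead\<close> satisfy \<open>Box (Box Falsum)\<close>, and of these only \<open>dead\<close> satisfies
  \<open>Box Falsum\<close>, so formulas tell them from the certificates.
\<close>

definition literal :: "bool \<Rightarrow> nat \<Rightarrow> nat" where "literal b x = prod_encode (of_bool b, x)"
definition certificate :: "nat \<Rightarrow> nat" where "certificate c = prod_encode (2, c)"
definition dead :: nat where "dead = prod_encode (3, 0)"
definition mark :: nat where "mark = prod_encode (4, 0)"

text \<open>The oracle enters only through the edge to \<open>mark\<close>. A negative literal sees
  its positive counterpart so that it can refer to the truth value there. A literal is coded as
  answer and argument, so an oracle claim can be read off its code directly. Numbers that code none
  of the intended worlds are harmless dead ends.\<close>

definition edge :: "nat set \<Rightarrow> nat \<Rightarrow> nat \<Rightarrow> bool" where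
  "edge A u v \<longleftrightarrow>
     pfst u = 0 \<and> v = literal True (psnd u) \<or>
     pfst u = 1 \<and> (v = dead \<or> v = mark \<and> psnd u \<in> A \<or>
       pfst v = 2 \<and> certifies (set_decode (psnd v)) (psnd u)) \<or>
     pfst u = 2 \<and> claim 4 (psnd v) (pfst v) \<in> set_decode (psnd u) \<or>
     u = mark \<and> v = dead"

lemma edge_simps:
  "edge A (literal False x) v \<longleftrightarrow> v = literal True x"
  "edge A (literal True x) v \<longleftrightarrow> v = dead \<or> v = mark \<and> x \<in> A \<or>
     (\<exists>c. v = certificate c \<and> certifies (set_decode c) x)"
  "edge A mark v \<longleftrightarrow> v = dead" "\<not> edge A dead v"
proof -
  have "pfst v = 2 \<and> certifies (set_decode (psnd v)) x \<longleftrightarrow>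
      (\<exists>c. v = certificate c \<and> certifies (set_decode c) x)"
    by (metis certificate_def eq_prod_encode_iff)
  then show "edge A (literal True x) v \<longleftrightarrow> v = dead \<or> v = mark \<and> x \<in> A \<or>
     (\<exists>c. v = certificate c \<and> certifies (set_decode c) x)"
    by (simp add: edge_def literal_def mark_def)
qed (simp_all add: edge_def literal_def dead_def mark_def)

lemma certifies_bit:
  assumes "certifies S x" "claim 4 z y \<in> S"
  shows "\<exists>b. y = of_bool b"
proof -
  have "y \<le> 1"
    using closed_claimsD[OF _ assms(2)] assms(1) by (simp add: certifies_def justified_basic)
  then have "y = of_bool (y = 1)" by auto
  then show ?thesis ..
qed

text \<open>The hypothesis forces all oracle answers to be 0 or 1; for arbitrary \<open>c\<close>
  there could be successors that are not literals.\<close>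

lemma edge_certificate_iff:
  assumes "certifies (set_decode c) x"
  shows "edge A (certificate c) v \<longleftrightarrow>
    (\<exists>b z. v = literal b z \<and> claim 4 z (of_bool b) \<in> set_decode c)"
proof -
  have "edge A (certificate c) v \<longleftrightarrow> claim 4 (psnd v) (pfst v) \<in> set_decode c"
    by (auto simp: edge_def certificate_def mark_def)
  also have "\<dots> \<longleftrightarrow> (\<exists>b z. v = literal b z \<and> claim 4 z (of_bool b) \<in> set_decode c)"
    using certifies_bit[OF assms]
    by (metis literal_def pfst_prod_encode psnd_prod_encode prod_encode_pfst_psnd)
  finally show ?thesis .
qed

lemma computable_frame_edge: "computable_frame A UNIV {(u, v). edge A u v}"
proof -
  have "decidable A (\<lambda>x. edge A (pfst x) (psnd x))"
    unfolding edge_def claim_def literal_def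
    by (intro decidable_intros decidable_certifies computable_intros)
  moreover have "x \<in> prod_encode ` {(u, v). edge A u v} \<longleftrightarrow> edge A (pfst x) (psnd x)" for x
  proof
    assume "edge A (pfst x) (psnd x)"
    then show "x \<in> prod_encode ` {(u, v). edge A u v}"
      by (intro image_eqI[of _ _ "(pfst x, psnd x)"]) simp_all
  qed auto
  ultimately show ?thesis
    by (simp add: computable_frame_def is_frame_def turing_le_iff_decidable decidable_const)
qed

section \<open>The defining formulas and the computability of their codes\<close>

abbreviation (input) Neg :: "fml \<Rightarrow> fml" where "Neg \<phi> \<equiv> Imp \<phi> Falsum"

text \<open>Positive literals satisfy \<open>positive_fml\<close> since they see the dead end; the only successor of
  \<open>literal False x\<close> is \<open>literal True x\<close>.\<close>

definition positive_fml :: fml where "positive_fml = Neg (Box (Neg (Box Falsum)))"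

text \<open>The outer shape \<open>Neg (Imp P (Neg Q))\<close> is the conjunction of
  \<open>P\<close> and \<open>Q\<close>, one conjunct for each sign of the literal.\<close>

definition literal_fml :: "fml \<Rightarrow> fml" where
  "literal_fml \<phi> =
     Neg (Imp (Imp positive_fml \<phi>) (Neg (Imp (Neg positive_fml) (Box (Neg \<phi>)))))"

text \<open>The shape \<open>Neg (Box (Imp P Q))\<close> is a diamond of \<open>P\<close> and not
  \<open>Q\<close>. At a positive literal the only possible witness is \<open>mark\<close>.\<close>

definition base_fml :: fml where
  "base_fml = Neg (Box (Imp (Box (Box Falsum)) (Box Falsum)))"

text \<open>The conclusion \<open>Box (Box Falsum)\<close> excludes \<open>dead\<close> and
  \<open>mark\<close> as witnesses of the diamond; \<open>dead\<close> satisfies every boxed formula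
  vacuously.\<close>

definition jump_step :: "fml \<Rightarrow> fml" where
  "jump_step \<phi> = Neg (Box (Imp (Box (literal_fml \<phi>)) (Box (Box Falsum))))"

definition jump_fml :: "nat \<Rightarrow> fml" where "jump_fml n = (jump_step ^^ n) base_fml"

definition num_computable :: "nat set \<Rightarrow> (fml \<Rightarrow> fml) \<Rightarrow> bool" where
  "num_computable A F \<longleftrightarrow> (\<exists>s. computable A s \<and> (\<forall>\<phi>. fml_num (F \<phi>) = s (fml_num \<phi>)))"

lemma num_computable_id: "num_computable A (\<lambda>\<phi>. \<phi>)"
  unfolding num_computable_def using computable_id by blast

lemma num_computable_const: "num_computable A (\<lambda>\<phi>. \<psi>)"
  unfolding num_computable_def using computable_const by blast

lemma num_computable_Box:
  assumes "num_computable A F"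
  shows "num_computable A (\<lambda>\<phi>. Box (F \<phi>))"
proof -
  obtain s where "computable A s" "\<And>\<phi>. fml_num (F \<phi>) = s (fml_num \<phi>)"
    using assms unfolding num_computable_def by blast
  then show ?thesis unfolding num_computable_def
    by (intro exI[of _ "\<lambda>x. 3 * s x + 3"] conjI computable_intros) simp_all
qed

lemma num_computable_Imp:
  assumes "num_computable A F" "num_computable A G"
  shows "num_computable A (\<lambda>\<phi>. Imp (F \<phi>) (G \<phi>))"
proof -
  obtain s where "computable A s" "\<And>\<phi>. fml_num (F \<phi>) = s (fml_num \<phi>)"
    using assms(1) unfolding num_computable_def by blast
  moreover obtain t where "computable A t" "\<And>\<phi>. fml_num (G \<phi>) = t (fml_num \<phi>)"
    using assms(2) unfolding num_computable_def by blast
  ultimately show ?thesis unfolding num_computable_def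
    by (intro exI[of _ "\<lambda>x. 3 * prod_encode (s x, t x) + 2"] conjI computable_intros) simp_all
qed

text \<open>Computability in \<open>n\<close> gives the uniformity that the omega-jump requires: one
  program finds the formulas for all finite jumps.\<close>

lemma computable_fml_num_funpow:
  assumes "num_computable A F"
  shows "computable A (\<lambda>n. fml_num ((F ^^ n) \<phi>))"
proof -
  obtain s where s: "computable A s" "\<And>\<phi>. fml_num (F \<phi>) = s (fml_num \<phi>)"
    using assms unfolding num_computable_def by blast
  have "fml_num ((F ^^ n) \<phi>) = rec_nat (fml_num \<phi>) (\<lambda>_. s) n" for n
    by (induction n) (simp_all add: s(2))
  then show ?thesis by (simp only:) (intro computable_intros computable_compose[OF s(1)])
qed

lemma computable_fml_num_jump_fml: "computable A (\<lambda>n. fml_num (jump_fml n))"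
  unfolding jump_fml_def jump_step_def literal_fml_def
  by (intro computable_fml_num_funpow num_computable_Imp num_computable_Box
      num_computable_id num_computable_const)

section \<open>Truth values under an arbitrary valuation\<close>

context
  fixes A :: "nat set" and V :: "nat \<times> fml \<Rightarrow> nat"
  assumes V: "valuation UNIV {(u, v). edge A u v} V"
begin

definition sat :: "nat \<Rightarrow> fml \<Rightarrow> bool" where "sat w \<phi> \<longleftrightarrow> V (w, \<phi>) = 1"

lemma sat_simps [simp]:
  "\<not> sat w Falsum" "sat w (Imp \<phi> \<psi>) \<longleftrightarrow> (sat w \<phi> \<longrightarrow> sat w \<psi>)"
  "sat w (Box \<phi>) \<longleftrightarrow> (\<forall>v. edge A w v \<longrightarrow> sat v \<phi>)"
proof -
  have V01: "V (w, \<phi>) \<in> {0, 1}" for \<phi> using V by (auto simp: valuation_def Pi_iff)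
  show "sat w (Imp \<phi> \<psi>) \<longleftrightarrow> (sat w \<phi> \<longrightarrow> sat w \<psi>)"
    using V V01[of \<phi>] V01[of \<psi>] by (auto simp: sat_def valuation_def)
qed (use V in \<open>simp_all add: sat_def valuation_def\<close>)

text \<open>\<open>positive_fml\<close> fails at a negative literal because its only successor sees
  \<open>dead\<close>. For the same literal, \<open>Box (Neg \<phi>)\<close> speaks about exactly
  that successor.\<close>

lemma sat_literal_fml:
  "sat (literal b x) (literal_fml \<phi>) \<longleftrightarrow> b = sat (literal True x) \<phi>"
proof (cases b)
  case True
  then show ?thesis by (auto simp: literal_fml_def positive_fml_def edge_simps)
next
  case False
  then show ?thesis by (auto simp: literal_fml_def positive_fml_def edge_simps)
qed

text \<open>A certificate contains an oracle claim and so sees a literal, and every literal has a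
  successor.\<close>

lemma not_sat_certificate:
  assumes "certifies (set_decode c) x"
  shows "\<not> sat (certificate c) (Box (Box Falsum))"
proof -
  obtain z y where "claim 4 z y \<in> set_decode c"
    using assms unfolding certifies_def by (metis claim_simps(4))
  moreover from this obtain b where "y = of_bool b" using certifies_bit[OF assms] by blast
  ultimately have "edge A (certificate c) (literal b z)"
    using edge_certificate_iff[OF assms] by blast
  moreover have "\<exists>v. edge A (literal b z) v" by (cases b) (auto simp: edge_simps)
  ultimately show ?thesis by auto
qed

text \<open>The successors of a certificate are its oracle claims read as literals, so the box runs
  through exactly the answers to be checked.\<close>

lemma sat_certificate:
  assumes c: "certifies (set_decode c) x"
    and B: "\<And>x. sat (literal True x) \<phi> \<longleftrightarrow> x \<in> B"
  shows "sat (certificate c) (Box (literal_fml \<phi>)) \<longleftrightarrow> query_correct B (set_decode c)"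
proof -
  have "sat (certificate c) (Box (literal_fml \<phi>)) \<longleftrightarrow>
      (\<forall>b z. claim 4 z (of_bool b) \<in> set_decode c \<longrightarrow> sat (literal b z) (literal_fml \<phi>))"
    unfolding sat_simps(3) edge_certificate_iff[OF c] by blast
  also have "\<dots> \<longleftrightarrow> (\<forall>b z. claim 4 z (of_bool b) \<in> set_decode c \<longrightarrow> b = (z \<in> B))"
    by (simp only: sat_literal_fml B)
  also have "\<dots> \<longleftrightarrow> (\<forall>y z. claim 4 z y \<in> set_decode c \<longrightarrow> y = of_bool (z \<in> B))"
  proof (rule iffI; intro allI impI)
    fix y z assume *: "\<forall>b z. claim 4 z (of_bool b) \<in> set_decode c \<longrightarrow> b = (z \<in> B)"
      and yz: "claim 4 z y \<in> set_decode c"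
    obtain b where "y = of_bool b" using certifies_bit[OF c yz] ..
    with * yz show "y = of_bool (z \<in> B)" by simp
  next
    fix b z assume "\<forall>y z. claim 4 z y \<in> set_decode c \<longrightarrow> y = of_bool (z \<in> B)"
      and "claim 4 z (of_bool b) \<in> set_decode c"
    then have "(of_bool b :: nat) = of_bool (z \<in> B)" by blast
    then show "b = (z \<in> B)" by (simp only: of_bool_eq_iff)
  qed
  also have "\<dots> \<longleftrightarrow> query_correct B (set_decode c)"
    unfolding query_correct_def by (metis claim_simps)
  finally show ?thesis .
qed

lemma sat_Neg_Box_Imp:
  "sat w (Neg (Box (Imp \<phi> \<psi>))) \<longleftrightarrow> (\<exists>v. edge A w v \<and> sat v \<phi> \<and> \<not> sat v \<psi>)"
  by auto

lemma sat_jump_fml: "sat (literal True x) (jump_fml n) \<longleftrightarrow> x \<in> (jump ^^ n) A"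
proof -
  let ?E = "\<lambda>v. sat v (Box (Box Falsum))"
  have E: "?E dead" "?E mark" "\<not> sat mark (Box Falsum)" "sat dead (Box Falsum)"
    by (auto simp: edge_simps)
  show ?thesis
  \<comment> \<open>The literal must vary, since a certificate for \<open>x\<close> may query other
    numbers.\<close>
  proof (induction n arbitrary: x)
    case 0
    have "sat (literal True x) (jump_fml 0) \<longleftrightarrow>
        (\<exists>v. edge A (literal True x) v \<and> ?E v \<and> \<not> sat v (Box Falsum))"
      unfolding jump_fml_def base_fml_def funpow_0 by (rule sat_Neg_Box_Imp)
    also have "\<dots> \<longleftrightarrow> x \<in> A"
      \<comment> \<open>Certificates fail the first condition and \<open>dead\<close> fails the
        second, which leaves \<open>mark\<close>.\<close>
      unfolding edge_simps(2) using E not_sat_certificate by blast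
    finally show ?case by simp
  next
    case (Suc n)
    let ?\<psi> = "Box (literal_fml (jump_fml n))"
    have "sat (literal True x) (jump_fml (Suc n)) \<longleftrightarrow>
        (\<exists>v. edge A (literal True x) v \<and> sat v ?\<psi> \<and> \<not> ?E v)"
      unfolding jump_fml_def funpow.simps o_apply jump_step_def[of "(jump_step ^^ n) base_fml"]
      by (rule sat_Neg_Box_Imp)
    also have "\<dots> \<longleftrightarrow> (\<exists>c. certifies (set_decode c) x \<and> sat (certificate c) ?\<psi>)"
      unfolding edge_simps(2) using E not_sat_certificate by blast
    also have "\<dots> \<longleftrightarrow> x \<in> jump ((jump ^^ n) A)"
      using sat_certificate[OF _ Suc.IH] unfolding mem_jump_iff_certifies by blast
    finally show ?case by simp
  qed
qed

end

theorem corollary2p13: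
  fixes A :: "nat set"
  shows "\<exists>W R. computable_frame A W R \<and>
           (\<forall>V. valuation W R V \<longrightarrow> omega_jump A \<le>\<^sub>T graph_of W V)"
proof (intro exI conjI allI impI)
  show "computable_frame A UNIV {(u, v). edge A u v}" by (rule computable_frame_edge)
next
  fix V assume V: "valuation UNIV {(u, v). edge A u v} V"
  let ?G = "graph_of UNIV V"
  \<comment> \<open>A single query to the graph of \<open>V\<close> decides membership: the
    reduction is many-one.\<close>
  have "z \<in> omega_jump A \<longleftrightarrow>
    prod_encode (prod_encode (literal True (psnd z), fml_num (jump_fml (pfst z))), 1) \<in> ?G" for z
  proof -
    have "z \<in> omega_jump A \<longleftrightarrow> psnd z \<in> (jump ^^ pfst z) A"
      by (auto simp: omega_jump_def) (metis prod_encode_pfst_psnd)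
    also have "\<dots> \<longleftrightarrow> V (literal True (psnd z), jump_fml (pfst z)) = 1"
      using sat_jump_fml[OF V] by (simp add: sat_def[OF V])
    also have "\<dots> \<longleftrightarrow>
      prod_encode (prod_encode (literal True (psnd z), fml_num (jump_fml (pfst z))), 1) \<in> ?G"
      by (auto simp: graph_of_def inj_eq[OF inj_fml_num])
    finally show ?thesis .
  qed
  then show "omega_jump A \<le>\<^sub>T ?G"
    unfolding turing_le_iff_decidable
    by (simp only: literal_def) (intro decidable_intros computable_intros
        computable_compose[OF computable_fml_num_jump_fml])
qed

end
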